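(* Let $n\geq 5$, and let $\alpha_n$ be an optimal set of $n$-means for the probability measure $P=\frac1{2^2}\delta_1+\frac12\delta_2+\sum_{j=3}^\infty\frac1{2^j}\delta_j$. Then $\alpha_n$ must contain the set $\{1,2,\dots,n-3\}$.
   Context: $\delta_x$ denotes the Dirac measure at $x\in\mathbb R$. For a Borel probability measure $P$ on $\mathbb R$ and a nonempty finite set $\alpha\subset\mathbb R$, the distortion error is $V(P;\alpha)=\int\min_{a\in\alpha}|x-a|^2\,dP(x)$. The $n$th quantization error is $V_n(P)=\inf\{V(P;\alpha):\alpha\subset\mathbb R,\ 1\le\mathrm{card}(\alpha)\le n\}$. An optimal set of $n$-means for $P$ is a set $\alpha$ with at most $n$ points for which this infimum is attained. *)

theory Defs
  imports "HOL-Probability.Probability"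
begin

text \<open>
  The distortion is a nonnegative integral with values in the extended nonnegative reals, so that
  a set of infinite distortion is never confused with one of distortion \<open>0\<close>. It is only
  meaningful for nonempty finite \<open>\<alpha>\<close>, where \<^const>\<open>Min\<close> is the genuine minimum.
\<close>

definition distortion_error :: "real measure \<Rightarrow> real set \<Rightarrow> ennreal" where
  "distortion_error P \<alpha> = (\<integral>\<^sup>+ x. ennreal (MIN a\<in>\<alpha>. \<bar>x - a\<bar>\<^sup>2) \<partial>P)"

definition codebooks :: "nat \<Rightarrow> real set set" where
  "codebooks n = {\<alpha>. finite \<alpha> \<and> 1 \<le> card \<alpha> \<and> card \<alpha> \<le> n}"

definition quantization_error :: "nat \<Rightarrow> real measure \<Rightarrow> ennreal" where
  "quantization_error n P = (INF \<alpha>\<in>codebooks n. distortion_error P \<alpha>)"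

definition optimal_n_means :: "nat \<Rightarrow> real measure \<Rightarrow> real set \<Rightarrow> bool" where
  "optimal_n_means n P \<alpha> \<longleftrightarrow>
     \<alpha> \<in> codebooks n \<and> distortion_error P \<alpha> = quantization_error n P"

text \<open>
  \<^term>\<open>return borel x\<close> is the Dirac measure at \<open>x\<close> on the Borel sets. The sum over
  \<open>j \<ge> 3\<close> is written with the shifted index \<open>j + 3\<close>, \<open>j \<ge> 0\<close>. The lemmas below show that the
  set function really is a measure, of total mass \<open>1\<close>.
\<close>

definition P_mass :: "real set \<Rightarrow> ennreal" where
  "P_mass A = ennreal (1 / 2 ^ 2) * emeasure (return borel (1::real)) A
     + ennreal (1 / 2) * emeasure (return borel (2::real)) A
     + (\<Sum>j::nat. ennreal (1 / 2 ^ (j + 3)) * emeasure (return borel (real (j + 3))) A)"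

definition P_dirac :: "real measure" where
  "P_dirac = measure_of UNIV (sets borel) P_mass"

lemma space_P_dirac [simp]: "space P_dirac = UNIV"
  by (simp add: P_dirac_def)

lemma sets_P_dirac [simp, measurable_cong]: "sets P_dirac = sets borel"
  using sets.sets_measure_of_eq[of borel] by (simp add: P_dirac_def)

lemma countably_additive_P_mass: "countably_additive (sets borel) P_mass"
proof (rule countably_additiveI)
  fix A :: "nat \<Rightarrow> real set"
  assume A: "range A \<subseteq> sets borel" "disjoint_family A"
  have d: "(\<Sum>i. emeasure (return borel x) (A i)) = emeasure (return borel x) (\<Union>(range A))"
    for x :: real
    using A by (intro suminf_emeasure) auto
  let ?f = "\<lambda>i j::nat. ennreal (1 / 2 ^ (j + 3)) * emeasure (return borel (real (j + 3))) (A i)"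
  have "(\<Sum>i. \<Sum>j. ?f i j) = (\<Sum>j. \<Sum>i. ?f i j)"
    using nn_integral_suminf[of "\<lambda>j i. ?f i j" "count_space UNIV"]
    by (simp add: nn_integral_count_space_nat)
  then show "(\<Sum>i. P_mass (A i)) = P_mass (\<Union>(range A))"
    unfolding P_mass_def
    by (simp add: suminf_add[symmetric] summableI d)
qed

lemma emeasure_P_dirac: "A \<in> sets borel \<Longrightarrow> emeasure P_dirac A = P_mass A"
  using countably_additive_P_mass
  by (intro emeasure_measure_of[OF P_dirac_def]) (auto simp: positive_def P_mass_def)

lemma prob_space_P_dirac: "prob_space P_dirac"
proof
  have "(\<lambda>j. (1/8) * (1 / 2 :: real) ^ j) sums (1/8 * (1 / (1 - 1 / 2)))"
    by (intro sums_mult geometric_sums) simp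
  then have "(\<lambda>j. 1 / 2 ^ (j + 3) :: real) sums (1 / 4)"
    by (simp add: power_add power_one_over mult.commute)
  then have "(\<Sum>j::nat. ennreal (1 / 2 ^ (j + 3))) = ennreal (1 / 4)"
    by (intro suminf_ennreal_eq) auto
  then have "emeasure P_dirac (space P_dirac) = ennreal (1 / 4) + ennreal (1 / 2) + ennreal (1 / 4)"
    by (simp add: emeasure_P_dirac P_mass_def)
  also have "\<dots> = ennreal (1 / 4 + 1 / 2 + 1 / 4)"
    by (subst ennreal_plus[symmetric]; simp)+
  finally show "emeasure P_dirac (space P_dirac) = 1"
    by simp
qed

end

theory Submission
  imports Defs "HOL-Real_Asymp.Real_Asymp"
begin

text \<open>
  If \<open>k \<le> n - 3\<close> and \<open>k + 1\<close> have a common nearest point in \<open>\<alpha>\<close>, these two atoms alone already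
  cost as much as an explicit \<open>n\<close>-point codebook, and since \<open>\<alpha>\<close> is finite the other atoms add a
  positive amount. So in an optimal \<open>\<alpha>\<close> a point nearest to \<open>k\<close> is nearest neither to \<open>k - 1\<close> nor
  to \<open>k + 1\<close>, hence, as Voronoi cells are convex, to no other atom. Moving it to \<open>k\<close> would
  strictly lower the distortion unless it is \<open>k\<close> already.
\<close>

section \<open>Atoms and squared distance to a codebook\<close>

text \<open>Giving index \<open>0\<close> mass zero lets all of \<open>nat\<close> index the atoms.
  Indices \<open>1\<close> and \<open>2\<close> carry the geometric weights in swapped
  order.\<close>

definition weight :: "nat \<Rightarrow> real" where
  "weight j = (if j = 0 then 0 else if j = 1 then 1/4 else if j = 2 then 1/2 else 1 / 2 ^ j)"

definition sqdist :: "real set \<Rightarrow> real \<Rightarrow> real" where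
  "sqdist \<alpha> x = (MIN a\<in>\<alpha>. \<bar>x - a\<bar>\<^sup>2)"

lemma weight_nonneg: "0 \<le> weight j"
  by (simp add: weight_def)

lemma weight_pos: "0 < j \<Longrightarrow> 0 < weight j"
  by (simp add: weight_def)

lemma sqdist_le: "finite \<alpha> \<Longrightarrow> a \<in> \<alpha> \<Longrightarrow> sqdist \<alpha> x \<le> \<bar>x - a\<bar>\<^sup>2"
  unfolding sqdist_def by (rule Min_le) auto

lemma sqdist_attained:
  assumes "finite \<alpha>" "\<alpha> \<noteq> {}"
  obtains a where "a \<in> \<alpha>" "sqdist \<alpha> x = \<bar>x - a\<bar>\<^sup>2"
proof -
  have "sqdist \<alpha> x \<in> (\<lambda>a. \<bar>x - a\<bar>\<^sup>2) ` \<alpha>"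
    unfolding sqdist_def using assms by (intro Min_in) auto
  then show ?thesis using that by auto
qed

lemma sqdist_nonneg: "finite \<alpha> \<Longrightarrow> \<alpha> \<noteq> {} \<Longrightarrow> 0 \<le> sqdist \<alpha> x"
  by (simp add: sqdist_def)

lemma sqdist_pos: "finite \<alpha> \<Longrightarrow> \<alpha> \<noteq> {} \<Longrightarrow> x \<notin> \<alpha> \<Longrightarrow> 0 < sqdist \<alpha> x"
  by (auto simp: sqdist_def)

lemma borel_measurable_sqdist:
  assumes "finite \<alpha>"
  shows "sqdist \<alpha> \<in> borel_measurable borel"
  unfolding sqdist_def[abs_def] using assms by (intro borel_measurable_Min) auto

section \<open>The distortion as a series over the atoms\<close>

text \<open>Turns integrals against \<open>P_dirac\<close> into series over \<open>nat\<close>.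
  Splitting off the indices below \<open>3\<close> matches the shift in
  \<open>P_mass\<close>.\<close>

lemma P_dirac_eq_distr:
  "P_dirac = distr (density (count_space UNIV) (\<lambda>j. ennreal (weight j))) borel real"
proof (rule measure_eqI)
  fix A assume "A \<in> sets P_dirac"
  then have A: "A \<in> sets borel" by simp
  have "emeasure (distr (density (count_space UNIV) (\<lambda>j. ennreal (weight j))) borel real) A
      = (\<Sum>j. ennreal (weight j) * indicator A (real j))"
    using A by (simp add: emeasure_distr emeasure_density nn_integral_count_space_nat indicator_def)
  also have "\<dots> = (\<Sum>j. ennreal (weight (j + 3)) * indicator A (real (j + 3)))
      + (\<Sum>j<3. ennreal (weight j) * indicator A (real j))"
    by (rule suminf_offset) (rule summableI)
  also have "\<dots> = P_mass A"
  proof -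
    have "weight (j + 3) = 1 / 2 ^ (j + 3)" for j
      by (simp add: weight_def)
    moreover have "(\<Sum>j<3. ennreal (weight j) * indicator A (real j))
        = ennreal (1/4) * indicator A 1 + ennreal (1/2) * indicator A 2"
      by (simp add: numeral_3_eq_3 weight_def)
    ultimately show ?thesis
      using A by (simp only: P_mass_def emeasure_return power2_eq_square add.commute) simp
  qed
  finally show "emeasure P_dirac A
      = emeasure (distr (density (count_space UNIV) (\<lambda>j. ennreal (weight j))) borel real) A"
    using A by (simp add: emeasure_P_dirac)
qed simp

lemma distortion_error_P_dirac:
  assumes "finite \<alpha>" "\<alpha> \<noteq> {}"
  shows "distortion_error P_dirac \<alpha> = (\<Sum>j. ennreal (weight j * sqdist \<alpha> (real j)))"
proof -
  have "distortion_error P_dirac \<alpha> = (\<integral>\<^sup>+x. ennreal (sqdist \<alpha> x) \<partial>P_dirac)"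
    by (simp add: distortion_error_def sqdist_def)
  also have "\<dots> = (\<integral>\<^sup>+j. ennreal (sqdist \<alpha> (real j))
      \<partial>density (count_space UNIV) (\<lambda>j. ennreal (weight j)))"
    unfolding P_dirac_eq_distr
    using borel_measurable_sqdist[OF assms(1)] by (subst nn_integral_distr) auto
  also have "\<dots> = (\<Sum>j. ennreal (weight j) * ennreal (sqdist \<alpha> (real j)))"
    by (simp add: nn_integral_density nn_integral_count_space_nat)
  finally show ?thesis
    by (simp add: ennreal_mult' weight_nonneg)
qed

text \<open>Real-valued series can be subtracted term by term, which the final comparison of two
  codebooks relies on.\<close>

lemma distortion_error_P_dirac_real:
  assumes "finite \<alpha>" "\<alpha> \<noteq> {}" "distortion_error P_dirac \<alpha> \<noteq> \<top>"
  shows "summable (\<lambda>j. weight j * sqdist \<alpha> (real j))"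
    and "distortion_error P_dirac \<alpha> = ennreal (\<Sum>j. weight j * sqdist \<alpha> (real j))"
proof -
  have nn: "0 \<le> weight j * sqdist \<alpha> (real j)" for j
    using assms by (simp add: weight_nonneg sqdist_nonneg)
  show s: "summable (\<lambda>j. weight j * sqdist \<alpha> (real j))"
    using assms nn distortion_error_P_dirac[OF assms(1,2)] by (intro summable_suminf_not_top) auto
  show "distortion_error P_dirac \<alpha> = ennreal (\<Sum>j. weight j * sqdist \<alpha> (real j))"
    unfolding distortion_error_P_dirac[OF assms(1,2)] using nn s by (rule suminf_ennreal2)
qed

section \<open>Upper bound for the quantization error\<close>

text \<open>This is the variance of the geometric distribution with masses
  \<open>1 / 2 ^ (m + 1)\<close> and mean \<open>1\<close>. The series telescopes through
  \<open>(m^2 + 2) / 2 ^ m\<close>.\<close>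

lemma sums_geometric_variance: "(\<lambda>m. (real m - 1)\<^sup>2 / 2 ^ (m + 1)) sums 2"
proof -
  have "(\<lambda>m. ((real m)\<^sup>2 + 2) / 2 ^ m) \<longlonglongrightarrow> 0"
    by real_asymp
  then have "(\<lambda>m. ((real m)\<^sup>2 + 2) / 2 ^ m - ((real (Suc m))\<^sup>2 + 2) / 2 ^ Suc m)
      sums (((real 0)\<^sup>2 + 2) / 2 ^ 0 - 0)"
    by (rule telescope_sums')
  moreover have "((real m)\<^sup>2 + 2) / 2 ^ m - ((real (Suc m))\<^sup>2 + 2) / 2 ^ Suc m
      = (real m - 1)\<^sup>2 / 2 ^ (m + 1)" for m
    by (simp add: field_simps power2_eq_square)
  ultimately show ?thesis by simp
qed

text \<open>
  The codebook serves \<open>1, \<dots>, n - 2\<close> exactly, the pair \<open>n - 1, n\<close> by its mean \<open>n - 1 + 1/3\<close>,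
  and the geometric tail from \<open>n + 1\<close> on by its mean \<open>n + 2\<close>.
\<close>
lemma quantization_error_le:
  assumes "n \<ge> 5"
  shows "quantization_error n P_dirac \<le> ennreal (8 / 3 / 2 ^ n)"
proof -
  define \<beta> where "\<beta> = insert (real n - 2/3) (insert (real n + 2) (real ` {1..n - 2}))"
  have fin: "finite \<beta>" "\<beta> \<noteq> {}"
    by (auto simp: \<beta>_def)
  have "card \<beta> \<le> Suc (Suc (card (real ` {1..n - 2})))"
    by (simp add: \<beta>_def card_insert_if)
  also have "\<dots> \<le> n"
    using assms card_image_le[of "{1..n - 2}" real] by simp
  finally have cb: "\<beta> \<in> codebooks n"
    using fin by (auto simp: codebooks_def Suc_le_eq card_gt_0_iff)
  \<comment> \<open>\<open>e j\<close> is the squared distance from \<open>j\<close> to the point of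
    \<open>\<beta>\<close> assigned to it. As only an upper bound for \<open>sqdist\<close> is
    wanted, that point need not be shown nearest. At \<open>j = 0\<close> the value \<open>0\<close>
    is harmless, since the weight vanishes.\<close>
  define e where "e j = (if j = n - 1 then 1/9 else if j = n then 4/9
      else if j \<le> n then 0 else (real j - real n - 2)\<^sup>2)" for j
  define h where "h j = weight j * e j" for j
  \<comment> \<open>Counted from \<open>n + 1\<close>, the tail is a geometric distribution scaled
    by \<open>1 / 2 ^ n\<close>, and \<open>n + 2\<close> sits at its mean
    \<open>m = 1\<close>.\<close>
  have tail: "h (m + (n + 1)) = (real m - 1)\<^sup>2 / 2 ^ (m + 1) * (1 / 2 ^ n)" for m
    using assms(1) by (auto simp: h_def e_def weight_def power_add field_simps)
  have "(\<Sum>j<n + 1. h j) = (\<Sum>j\<in>{n - 1, n}. h j)"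
    by (rule sum.mono_neutral_right) (auto simp: h_def e_def)
  \<comment> \<open>Since \<open>n - 1 \<ge> 3\<close>, both weights are geometric: the pair costs
    \<open>(2 * 1/9 + 4/9) / 2 ^ n\<close>.\<close>
  also have "\<dots> = 2/3 / 2 ^ n"
  proof -
    obtain m where "n = Suc m" using assms by (cases n) auto
    then show ?thesis using assms by (simp add: h_def e_def weight_def field_simps)
  qed
  finally have head: "(\<Sum>j<n + 1. h j) = 2/3 / 2 ^ n" .
  have "(\<lambda>m. h (m + (n + 1))) sums (2 * (1 / 2 ^ n))"
    unfolding tail by (intro sums_mult2 sums_geometric_variance)
  then have "h sums (2 * (1 / 2 ^ n) + 2/3 / 2 ^ n)"
    unfolding sums_iff_shift head[symmetric] by simp
  then have hs: "h sums (8 / 3 / 2 ^ n)"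
    by simp
  have near: "sqdist \<beta> (real j) \<le> e j" if "b \<in> \<beta>" "\<bar>real j - b\<bar>\<^sup>2 = e j" for j b
    using sqdist_le[OF fin(1) that(1), of "real j"] that(2) by simp
  have le: "weight j * sqdist \<beta> (real j) \<le> h j" for j
  proof -
    consider "j = 0" | "j = n - 1" | "j = n" | "n < j" | "1 \<le> j" "j \<le> n - 2"
      by linarith
    then show ?thesis
    proof cases
      case 1
      then show ?thesis by (simp add: h_def weight_def)
    next
      case 2
      then have "e j = 1/9" by (simp add: e_def)
      with 2 have "sqdist \<beta> (real j) \<le> e j"
        using assms by (intro near[of "real n - 2/3"]) (auto simp: \<beta>_def of_nat_diff power2_eq_square)
      then show ?thesis unfolding h_def by (intro mult_left_mono weight_nonneg)
    next
      case 3
      then have "e j = 4/9" using assms by (simp add: e_def)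
      with 3 have "sqdist \<beta> (real j) \<le> e j"
        by (intro near[of "real n - 2/3"]) (auto simp: \<beta>_def power2_eq_square)
      then show ?thesis unfolding h_def by (intro mult_left_mono weight_nonneg)
    next
      case 4
      then have "e j = (real j - real n - 2)\<^sup>2" by (simp add: e_def)
      then have "sqdist \<beta> (real j) \<le> e j"
        by (intro near[of "real n + 2"]) (simp_all add: \<beta>_def diff_diff_eq)
      then show ?thesis unfolding h_def by (intro mult_left_mono weight_nonneg)
    next
      case 5
      then have "j < n - 1" "j < n" using assms by linarith+
      then have "e j = 0" by (simp add: e_def)
      with 5 have "sqdist \<beta> (real j) \<le> e j"
        by (intro near[of "real j"]) (simp_all add: \<beta>_def)
      then show ?thesis unfolding h_def by (intro mult_left_mono weight_nonneg)
    qed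
  qed
  have hn: "0 \<le> h j" for j
    by (simp add: h_def e_def weight_nonneg)
  have "quantization_error n P_dirac \<le> distortion_error P_dirac \<beta>"
    unfolding quantization_error_def using cb by (rule INF_lower)
  also have "\<dots> \<le> (\<Sum>j. ennreal (h j))"
    unfolding distortion_error_P_dirac[OF fin] by (intro suminf_le ennreal_leI le) auto
  also have "\<dots> = ennreal (8 / 3 / 2 ^ n)"
    using hs hn by (intro suminf_ennreal_eq) auto
  finally show ?thesis .
qed

section \<open>Lower bound for two atoms sharing a point\<close>

text \<open>Equality holds when \<open>a\<close> is the weighted mean of \<open>x\<close> and \<open>x + 1\<close>.\<close>
lemma two_point_variance_le:
  fixes u v x a :: real
  assumes "u > 0" "v > 0"
  shows "u * v / (u + v) \<le> u * \<bar>x - a\<bar>\<^sup>2 + v * \<bar>x + 1 - a\<bar>\<^sup>2"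
proof -
  have "(u * \<bar>x - a\<bar>\<^sup>2 + v * \<bar>x + 1 - a\<bar>\<^sup>2) * (u + v) - u * v = (u * (x - a) + v * (x + 1 - a))\<^sup>2"
    by (simp add: power2_eq_square algebra_simps)
  then have "u * v \<le> (u * \<bar>x - a\<bar>\<^sup>2 + v * \<bar>x + 1 - a\<bar>\<^sup>2) * (u + v)"
    by (metis diff_ge_0_iff_ge zero_le_power2)
  then show ?thesis using assms by (simp add: pos_divide_le_eq)
qed

text \<open>For \<open>k \<ge> 3\<close> the right side is \<open>1 / (3 * 2 ^ k)\<close>, so the
  bound amounts to \<open>k + 3 \<le> n\<close>, with equality at \<open>k = n - 3\<close>. For
  \<open>k = 1\<close> and \<open>k = 2\<close> it is \<open>1/6\<close> and \<open>1/10\<close>,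
  both above \<open>1/12\<close>, the value of the left side at \<open>n = 5\<close>.\<close>

lemma weight_pair_ge:
  assumes "n \<ge> 5" "1 \<le> k" "k \<le> n - 3"
  shows "8 / 3 / 2 ^ n \<le> weight k * weight (k + 1) / (weight k + weight (k + 1))"
proof -
  have "(2::real) ^ 5 \<le> 2 ^ n" using assms by (intro power_increasing) auto
  then have n: "8 / 3 / 2 ^ n \<le> (1 / 12 :: real)" by (simp add: field_simps)
  consider "k = 1" | "k = 2" | "k \<ge> 3" using assms by linarith
  then show ?thesis
  proof cases
    case 3
    have "(2::real) ^ (k + 3) \<le> 2 ^ n" using assms by (intro power_increasing) auto
    then have "8 / 3 / 2 ^ n \<le> (1 / 3 / 2 ^ k :: real)" by (simp add: field_simps power_add)
    also have "\<dots> = weight k * weight (k + 1) / (weight k + weight (k + 1))"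
      using 3 by (simp add: weight_def field_simps)
    finally show ?thesis .
  qed (use n in \<open>simp_all add: weight_def numeral_3_eq_3[symmetric]\<close>)
qed

section \<open>Convexity of Voronoi cells\<close>

text \<open>The difference of the two squared distances is affine in the point, with slope
  \<open>2 * (b - a)\<close>. The sign of the slope decides which endpoint controls
  \<open>y\<close>.\<close>

lemma voronoi_cell_convex:
  fixes a b x y z :: real
  assumes "\<bar>x - a\<bar>\<^sup>2 \<le> \<bar>x - b\<bar>\<^sup>2" "\<bar>z - a\<bar>\<^sup>2 \<le> \<bar>z - b\<bar>\<^sup>2" "x \<le> y" "y \<le> z"
  shows "\<bar>y - a\<bar>\<^sup>2 \<le> \<bar>y - b\<bar>\<^sup>2"
proof (cases "a \<le> b")
  case True
  then have "(b - a) * y \<le> (b - a) * z" using assms by (intro mult_left_mono) auto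
  then show ?thesis using assms(2) by (simp add: power2_eq_square algebra_simps)
next
  case False
  then have "(a - b) * x \<le> (a - b) * y" using assms by (intro mult_left_mono) auto
  then show ?thesis using assms(1) by (simp add: power2_eq_square algebra_simps)
qed

text \<open>A point \<open>b\<close> nearest to \<open>y\<close> is no closer than \<open>a\<close>
  at \<open>x\<close> and at \<open>z\<close>, hence by convexity no closer at
  \<open>y\<close>.\<close>

lemma sqdist_eq_between:
  assumes "finite \<alpha>" "a \<in> \<alpha>" "x \<le> y" "y \<le> z"
    and "sqdist \<alpha> x = \<bar>x - a\<bar>\<^sup>2" "sqdist \<alpha> z = \<bar>z - a\<bar>\<^sup>2"
  shows "sqdist \<alpha> y = \<bar>y - a\<bar>\<^sup>2"
proof (rule antisym)
  show "sqdist \<alpha> y \<le> \<bar>y - a\<bar>\<^sup>2" using assms sqdist_le by blast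
  obtain b where b: "b \<in> \<alpha>" "sqdist \<alpha> y = \<bar>y - b\<bar>\<^sup>2"
    using assms(1,2) by (metis sqdist_attained empty_iff)
  have "\<bar>x - a\<bar>\<^sup>2 \<le> \<bar>x - b\<bar>\<^sup>2" "\<bar>z - a\<bar>\<^sup>2 \<le> \<bar>z - b\<bar>\<^sup>2"
    using sqdist_le[OF assms(1) b(1)] assms(5,6) by metis+
  then show "\<bar>y - a\<bar>\<^sup>2 \<le> sqdist \<alpha> y"
    unfolding b(2) using assms(3,4) by (rule voronoi_cell_convex)
qed

section \<open>Separation of the atoms and exchange of one point\<close>

theorem proposition3p2p1:
  fixes n :: nat and \<alpha> :: "real set"
  assumes "n \<ge> 5"
    and "optimal_n_means n P_dirac \<alpha>"
  shows "real ` {1..n - 3} \<subseteq> \<alpha>"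
proof (rule ccontr)
  assume "\<not> real ` {1..n - 3} \<subseteq> \<alpha>"
  then obtain k where "k \<in> {1..n - 3}" and k: "real k \<notin> \<alpha>" by blast
  then have k: "1 \<le> k" "k \<le> n - 3" "real k \<notin> \<alpha>" by auto
  have cb: "\<alpha> \<in> codebooks n" and opt: "distortion_error P_dirac \<alpha> = quantization_error n P_dirac"
    using assms(2) by (auto simp: optimal_n_means_def)
  have fin: "finite \<alpha>" "\<alpha> \<noteq> {}"
    using cb by (auto simp: codebooks_def)
  define G where "G j = weight j * sqdist \<alpha> (real j)" for j
  have le: "distortion_error P_dirac \<alpha> \<le> ennreal (8 / 3 / 2 ^ n)"
    unfolding opt using assms(1) by (rule quantization_error_le)
  then have nt: "distortion_error P_dirac \<alpha> \<noteq> \<top>"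
    by (rule neq_top_trans[OF ennreal_neq_top])
  have sG: "summable G" and eG: "distortion_error P_dirac \<alpha> = ennreal (suminf G)"
    using distortion_error_P_dirac_real[OF fin nt] by (auto simp: G_def[abs_def])
  have G0: "0 \<le> G j" for j
    using fin by (simp add: G_def weight_nonneg sqdist_nonneg)
  have G_le: "suminf G \<le> 8 / 3 / 2 ^ n"
    using le unfolding eG by (simp add: ennreal_le_iff)
  have separated: False
    if "1 \<le> i" "i \<le> n - 3" "sqdist \<alpha> (real i) = \<bar>real i - a\<bar>\<^sup>2"
      "sqdist \<alpha> (real (i + 1)) = \<bar>real (i + 1) - a\<bar>\<^sup>2" for i a
  proof -
    \<comment> \<open>The pair alone may cost exactly \<open>8 / 3 / 2 ^ n\<close>, so strictness
      has to come from a further atom \<open>j\<close> missed by the finite set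
      \<open>\<alpha>\<close>.\<close>
    have "infinite ({i + 2..} - real -` \<alpha>)"
      by (intro Diff_infinite_finite finite_vimageI) (auto simp: fin infinite_Ici)
    then obtain j where j: "j \<ge> i + 2" "real j \<notin> \<alpha>"
      by (metis Diff_iff atLeast_iff ex_in_conv finite.emptyI vimageI)
    have "8 / 3 / 2 ^ n \<le> weight i * weight (i + 1) / (weight i + weight (i + 1))"
      using assms(1) that by (intro weight_pair_ge) auto
    also have "\<dots> \<le> weight i * \<bar>real i - a\<bar>\<^sup>2 + weight (i + 1) * \<bar>real i + 1 - a\<bar>\<^sup>2"
      using that by (intro two_point_variance_le weight_pos) auto
    also have "\<dots> = G i + G (i + 1)"
      using that by (simp add: G_def add.commute)
    also have "\<dots> < G i + G (i + 1) + G j"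
      using j fin by (simp add: G_def weight_pos sqdist_pos)
    also have "\<dots> = sum G {i, i + 1, j}"
      using j by simp
    also have "\<dots> \<le> suminf G"
      using sG G0 by (intro sum_le_suminf) auto
    finally show False using G_le by simp
  qed
  obtain a where a: "a \<in> \<alpha>" "sqdist \<alpha> (real k) = \<bar>real k - a\<bar>\<^sup>2"
    using fin sqdist_attained by blast
  \<comment> \<open>If \<open>a\<close> also served another atom, convexity would make it serve the
    neighbour of \<open>k\<close> on that side, against \<open>separated\<close>. For
    \<open>j < k\<close>, the condition \<open>j \<ge> 1\<close> ensures that \<open>k - 1\<close>
    is still an atom.\<close>
  have only: "j = k" if "j \<ge> 1" "sqdist \<alpha> (real j) = \<bar>real j - a\<bar>\<^sup>2" for j
  proof (rule ccontr)
    assume "j \<noteq> k"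
    then consider "k < j" | "j < k" by linarith
    then show False
    proof cases
      case 1
      then have "sqdist \<alpha> (real (k + 1)) = \<bar>real (k + 1) - a\<bar>\<^sup>2"
        by (intro sqdist_eq_between[OF fin(1) a(1) _ _ a(2) that(2)]) auto
      then show False using separated[of k a] k a by blast
    next
      case 2
      then have "sqdist \<alpha> (real (k - 1)) = \<bar>real (k - 1) - a\<bar>\<^sup>2"
        by (intro sqdist_eq_between[OF fin(1) a(1) _ _ that(2) a(2)]) auto
      moreover have "1 \<le> k - 1" "k - 1 \<le> n - 3" "k - 1 + 1 = k"
        using k 2 that(1) by linarith+
      ultimately show False using separated[of "k - 1" a] a(2) by simp
    qed
  qed
  \<comment> \<open>Moving \<open>a\<close> to \<open>k\<close> keeps the cardinality, as
    \<open>k\<close> is not in \<open>\<alpha>\<close>. By \<open>only\<close>, every other atom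
    keeps its nearest points.\<close>
  define \<beta> where "\<beta> = insert (real k) (\<alpha> - {a})"
  have finb: "finite \<beta>" "\<beta> \<noteq> {}"
    using fin by (auto simp: \<beta>_def)
  have "card \<beta> = card \<alpha>"
    using card_Suc_Diff1[OF fin(1) a(1)] fin k by (simp add: \<beta>_def del: card_Diff_insert)
  then have cbb: "\<beta> \<in> codebooks n"
    using cb finb by (simp add: codebooks_def)
  define F where "F j = weight j * sqdist \<beta> (real j)" for j
  have F0: "0 \<le> F j" for j
    using finb by (simp add: F_def weight_nonneg sqdist_nonneg)
  have FG: "F j \<le> G j" for j
  proof -
    consider "j = 0" | "j = k" | "j \<ge> 1" "j \<noteq> k" by linarith
    then show ?thesis
    proof cases
      case 1
      then show ?thesis by (simp add: F_def G_def weight_def)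
    next
      case 2
      then have "sqdist \<beta> (real j) \<le> 0"
        using sqdist_le[of \<beta> "real k" "real k"] finb by (simp add: \<beta>_def)
      also have "\<dots> \<le> sqdist \<alpha> (real j)" using fin by (rule sqdist_nonneg)
      finally show ?thesis
        unfolding F_def G_def by (intro mult_left_mono weight_nonneg)
    next
      case 3
      obtain b where b: "b \<in> \<alpha>" "sqdist \<alpha> (real j) = \<bar>real j - b\<bar>\<^sup>2"
        using fin sqdist_attained by blast
      then have "b \<in> \<beta>" using only 3 by (auto simp: \<beta>_def)
      then have "sqdist \<beta> (real j) \<le> sqdist \<alpha> (real j)"
        unfolding b(2) using finb by (intro sqdist_le)
      then show ?thesis
        unfolding F_def G_def by (intro mult_left_mono weight_nonneg)
    qed
  qed
  \<comment> \<open>The cost of atom \<open>k\<close> drops from a positive value to zero; this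
    single strict term makes the whole series smaller.\<close>
  have "F k \<le> 0"
    using sqdist_le[of \<beta> "real k" "real k"] finb weight_nonneg[of k]
    by (simp add: F_def \<beta>_def mult_nonneg_nonpos)
  also have "0 < G k"
    using fin k by (simp add: G_def weight_pos sqdist_pos)
  finally have Fk: "F k < G k" .
  have sF: "summable F"
    by (rule summable_comparison_test'[OF sG, of 0]) (simp add: F0 FG)
  have "0 < (\<Sum>j. G j - F j)"
    by (rule suminf_pos2[OF summable_diff[OF sG sF], of k]) (simp_all add: FG Fk)
  then have lt: "suminf F < suminf G"
    using suminf_diff[OF sG sF] by simp
  have "distortion_error P_dirac \<beta> = (\<Sum>j. ennreal (F j))"
    unfolding distortion_error_P_dirac[OF finb] F_def ..
  also have "\<dots> = ennreal (suminf F)"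
    using F0 sF by (rule suminf_ennreal2)
  also have "\<dots> < distortion_error P_dirac \<alpha>"
    unfolding eG using lt suminf_nonneg[OF sF F0] by (simp add: ennreal_less_iff)
  also have "\<dots> \<le> distortion_error P_dirac \<beta>"
    unfolding opt quantization_error_def using cbb by (rule INF_lower)
  finally show False by simp
qed

end
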